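(* Let $\mathbf{E},\mathbf{A}\in\mathbb{R}^{n\times n}$, $\mathbf{B}\in\mathbb{R}^{n\times 1}$, $\mathbf{C}\in\mathbb{R}^{1\times n}$, with $\mathbf{E}$ nonsingular and all eigenvalues of the pencil $\lambda\mathbf{E}-\mathbf{A}$ in the open left half-plane, and let $\mathbf{H}(s)=\mathbf{C}(s\mathbf{E}-\mathbf{A})^{-1}\mathbf{B}$. Let $\omega_1,\dots,\omega_{N_q}\in\mathbb{R}$ and $\phi_1,\dots,\phi_{N_q}\in\mathbb{R}$ (quadrature nodes $\dot\imath\omega_i$ and weights $\phi_i^2$), and let $\eta_1^{(k)},\ldots,\eta_r^{(k)}\in\mathbb{C}$ be shifts (associated with iteration step $k$), none of which is an eigenvalue of $\lambda\mathbf{E}-\mathbf{A}$. Let $\widetilde{\mathbb{L}}^{(k)},\widetilde{\mathbb{M}}^{(k)}\in\mathbb{C}^{N_q\times r}$, $\widetilde{\mathbb{V}}\in\mathbb{C}^{N_q\times 1}$ and $\widetilde{\mathbb{W}}\in\mathbb{C}^{1\times r}$ be the matrices and vectors defined in the context. Then for any $1\le i\le N_q$ and $1\le j\le r$: $$\left(\widetilde{\mathbb{L}}^{(k)}\right)_{i,j}=-\phi_i\,\frac{\mathbf{H}(\dot\imath\omega_i)-\mathbf{H}(\eta_j^{(k)})}{\dot\imath\omega_i-\eta_j^{(k)}},$$ $$\left(\widetilde{\mathbb{M}}^{(k)}\right)_{i,j}=-\phi_i\,\frac{\dot\imath\omega_i\,\mathbf{H}(\dot\imath\omega_i)-\eta_j^{(k)}\,\mathbf{H}(\eta_j^{(k)})}{\dot\imath\omega_i-\eta_j^{(k)}},$$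 $$\left(\widetilde{\mathbb{V}}\right)_i=\phi_i\,\mathbf{H}(\dot\imath\omega_i),\qquad \left(\widetilde{\mathbb{W}}\right)_j=\mathbf{H}(\eta_j^{(k)}).$$
   Context: Here $\dot\imath$ is the imaginary unit and $(\cdot)^*$ is the conjugate transpose. The $1\times1$ matrix $\mathbf{H}(s)$ (transfer function of the single-input single-output system $\mathbf{E}\dot{\mathbf{x}}=\mathbf{A}\mathbf{x}+\mathbf{B}\mathbf{u}$, $\mathbf{y}=\mathbf{C}\mathbf{x}$) is identified with a scalar. Define $\widetilde{\mathbf{L}}\in\mathbb{C}^{n\times N_q}$ by $$\widetilde{\mathbf{L}}^*=\begin{bmatrix}\phi_1\mathbf{C}(\dot\imath\omega_1\mathbf{E}-\mathbf{A})^{-1}\\ \vdots\\ \phi_{N_q}\mathbf{C}(\dot\imath\omega_{N_q}\mathbf{E}-\mathbf{A})^{-1}\end{bmatrix}\in\mathbb{C}^{N_q\times n},$$ and $$\mathbf{V}_r^{(k)}=\begin{bmatrix}(\eta_1^{(k)}\mathbf{E}-\mathbf{A})^{-1}\mathbf{B}&\cdots&(\eta_r^{(k)}\mathbf{E}-\mathbf{A})^{-1}\mathbf{B}\end{bmatrix}\in\mathbb{C}^{n\times r}.$$ Then set $$\widetilde{\mathbb{L}}^{(k)}=\widetilde{\mathbf{L}}^*\mathbf{E}\mathbf{V}_r^{(k)},\quad \widetilde{\mathbb{M}}^{(k)}=\widetilde{\mathbf{L}}^*\mathbf{A}\mathbf{V}_r^{(k)},\quad \widetilde{\mathbb{V}}=\widetilde{\mathbf{L}}^*\mathbf{B},\quad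 \widetilde{\mathbb{W}}=\mathbf{C}\mathbf{V}_r^{(k)}.$$
   Formalization: The formulas for the entries of the first two matrices are stated only for those i, j with iω_i ≠ η_j, since otherwise the quotients are 0/0 and undefined; the other two formulas hold without restriction. *)

theory Defs
  imports "HOL-Analysis.Analysis"
begin

text \<open>
  An \<open>m \<times> n\<close> matrix over \<open>'a\<close> has type \<open>'a ^ 'n ^ 'm\<close>, so \<open>real ^ 1 ^ 'n\<close> is a column,
  \<open>real ^ 'n ^ 1\<close> is a row, and \<open>complex ^ 1 ^ 1\<close> is a \<open>1 \<times> 1\<close> matrix. The index types
  \<open>'n\<close>, \<open>'q\<close>, \<open>'r\<close> stand for \<open>{1..n}\<close>, \<open>{1..N\<^sub>q}\<close>, \<open>{1..r}\<close>.
\<close>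

abbreviation cplx :: "real ^ 'n ^ 'm \<Rightarrow> complex ^ 'n ^ 'm" where
  "cplx \<equiv> map_matrix complex_of_real"

definition conj_transpose :: "complex ^ 'n ^ 'm \<Rightarrow> complex ^ 'm ^ 'n" where
  "conj_transpose X = transpose (map_matrix cnj X)"

definition pencil :: "real ^ 'n ^ 'n \<Rightarrow> real ^ 'n ^ 'n \<Rightarrow> complex \<Rightarrow> complex ^ 'n ^ 'n" where
  "pencil E A s = (\<chi> k l. s * cplx E $ k $ l) - cplx A"

definition pencil_eigenvalue :: "real ^ 'n ^ 'n \<Rightarrow> real ^ 'n ^ 'n \<Rightarrow> complex \<Rightarrow> bool" where
  "pencil_eigenvalue E A lam \<longleftrightarrow> (\<exists>v. v \<noteq> 0 \<and> cplx A *v v = lam *s (cplx E *v v))"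

text \<open>The \<open>1 \<times> 1\<close> matrix \<open>H(s)\<close> is identified with its only entry. Here and below
  \<^const>\<open>matrix_inv\<close> is the inverse only when \<open>s E - A\<close> is invertible, i.e. when \<open>s\<close> is not an
  eigenvalue of the pencil; otherwise its value is unspecified.\<close>

definition transfer_fun ::
  "real ^ 'n ^ 'n \<Rightarrow> real ^ 'n ^ 'n \<Rightarrow> real ^ 1 ^ 'n \<Rightarrow> real ^ 'n ^ 1 \<Rightarrow> complex \<Rightarrow> complex" where
  "transfer_fun E A B C s = (cplx C ** matrix_inv (pencil E A s) ** cplx B) $ 1 $ 1"

text \<open>\<open>L_tilde\<close> is specified through the rows of its conjugate transpose.\<close>

definition L_tilde ::
  "real ^ 'n ^ 'n \<Rightarrow> real ^ 'n ^ 'n \<Rightarrow> real ^ 'n ^ 1 \<Rightarrow> ('q \<Rightarrow> real) \<Rightarrow> ('q \<Rightarrow> real)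
    \<Rightarrow> complex ^ 'q ^ 'n" where
  "L_tilde E A C \<omega> \<phi> = conj_transpose
     (\<chi> i. complex_of_real (\<phi> i) *s
             row 1 (cplx C ** matrix_inv (pencil E A (\<i> * complex_of_real (\<omega> i)))))"

lemma conj_transpose_L_tilde:
  "conj_transpose (L_tilde E A C \<omega> \<phi>) =
     (\<chi> i. complex_of_real (\<phi> i) *s
             row 1 (cplx C ** matrix_inv (pencil E A (\<i> * complex_of_real (\<omega> i)))))"
  by (simp add: L_tilde_def conj_transpose_def transpose_def map_matrix_def vec_eq_iff)

definition V_r ::
  "real ^ 'n ^ 'n \<Rightarrow> real ^ 'n ^ 'n \<Rightarrow> real ^ 1 ^ 'n \<Rightarrow> ('r \<Rightarrow> complex) \<Rightarrow> complex ^ 'r ^ 'n" where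
  "V_r E A B \<eta> = (\<chi> l j. column 1 (matrix_inv (pencil E A (\<eta> j)) ** cplx B) $ l)"

definition LL_tilde ::
  "real ^ 'n ^ 'n \<Rightarrow> real ^ 'n ^ 'n \<Rightarrow> real ^ 1 ^ 'n \<Rightarrow> real ^ 'n ^ 1
    \<Rightarrow> ('q \<Rightarrow> real) \<Rightarrow> ('q \<Rightarrow> real) \<Rightarrow> ('r \<Rightarrow> complex) \<Rightarrow> complex ^ 'r ^ 'q" where
  "LL_tilde E A B C \<omega> \<phi> \<eta> = conj_transpose (L_tilde E A C \<omega> \<phi>) ** cplx E ** V_r E A B \<eta>"

definition MM_tilde ::
  "real ^ 'n ^ 'n \<Rightarrow> real ^ 'n ^ 'n \<Rightarrow> real ^ 1 ^ 'n \<Rightarrow> real ^ 'n ^ 1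
    \<Rightarrow> ('q \<Rightarrow> real) \<Rightarrow> ('q \<Rightarrow> real) \<Rightarrow> ('r \<Rightarrow> complex) \<Rightarrow> complex ^ 'r ^ 'q" where
  "MM_tilde E A B C \<omega> \<phi> \<eta> = conj_transpose (L_tilde E A C \<omega> \<phi>) ** cplx A ** V_r E A B \<eta>"

definition VV_tilde ::
  "real ^ 'n ^ 'n \<Rightarrow> real ^ 'n ^ 'n \<Rightarrow> real ^ 1 ^ 'n \<Rightarrow> real ^ 'n ^ 1
    \<Rightarrow> ('q \<Rightarrow> real) \<Rightarrow> ('q \<Rightarrow> real) \<Rightarrow> complex ^ 1 ^ 'q" where
  "VV_tilde E A B C \<omega> \<phi> = conj_transpose (L_tilde E A C \<omega> \<phi>) ** cplx B"

definition WW_tilde ::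
  "real ^ 'n ^ 'n \<Rightarrow> real ^ 'n ^ 'n \<Rightarrow> real ^ 1 ^ 'n \<Rightarrow> real ^ 'n ^ 1
    \<Rightarrow> ('r \<Rightarrow> complex) \<Rightarrow> complex ^ 'r ^ 1" where
  "WW_tilde E A B C \<eta> = cplx C ** V_r E A B \<eta>"

end

theory Submission
  imports Defs
begin

text \<open>
  Everything follows from two resolvent identities: for \<open>P = s E - A\<close> and \<open>Q = t E - A\<close> one has
  \<open>Q - P = (t - s) E\<close> and \<open>s Q - t P = (t - s) A\<close>; multiply by \<open>P\<^sup>-\<^sup>1\<close> from the left and by
  \<open>Q\<^sup>-\<^sup>1\<close> from the right, then sandwich between \<open>C\<close> and \<open>B\<close>. The imaginary axis carries no
  eigenvalues because all of them lie in the open left half-plane.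
\<close>

text \<open>Complex scaling is written as multiplication by \<open>mat c\<close>, so that scalars
  take part in the associativity and commutation of matrix products.\<close>

lemma mat_mult_nth: "(mat c ** X) $ i $ j = c * X $ i $ j"
  for X :: "'a::comm_semiring_1 ^ 'n ^ 'm::finite"
  by (simp add: matrix_matrix_mult_def mat_def if_distrib[of "\<lambda>x. x * _"] cong: if_cong)

lemma mult_mat_nth: "(X ** mat c) $ i $ j = c * X $ i $ j"
  for X :: "'a::comm_semiring_1 ^ 'n::finite ^ 'm"
  by (simp add: matrix_matrix_mult_def mat_def if_distrib[of "\<lambda>x. _ * x"] mult.commute cong: if_cong)

lemma mat_mult_commute: "mat c ** X = X ** mat c"
  for X :: "'a::comm_semiring_1 ^ 'n::finite ^ 'm::finite"
  by (simp add: vec_eq_iff mat_mult_nth mult_mat_nth)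

text \<open>Together with \<open>mult_columns\<close>, this reduces products of the stacked matrices
  to products with a single resolvent per row or column.\<close>

lemma scaled_rows_mult:
  "(\<chi> i. c i *s row k (R i)) ** X = (\<chi> i. c i *s row k (R i ** X))"
  for X :: "'a::comm_semiring_1 ^ 'p ^ 'n::finite"
  by (simp add: vec_eq_iff row_def matrix_matrix_mult_def sum_distrib_left mult.assoc)

lemma mult_columns:
  "X ** (\<chi> l j. column k (D j) $ l) = (\<chi> l j. column k (X ** D j) $ l)"
  for X :: "'a::comm_semiring_1 ^ 'n::finite ^ 'm"
  by (simp add: vec_eq_iff column_def matrix_matrix_mult_def)

lemma matrix_diff_ldistrib: "X ** (Y - Z) = X ** Y - X ** Z"
  for X :: "'a::ring_1 ^ 'n::finite ^ 'm"
  by (simp add: vec_eq_iff matrix_matrix_mult_def right_diff_distrib sum_subtractf)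

lemma matrix_diff_rdistrib: "(X - Y) ** Z = X ** Z - Y ** Z"
  for X :: "'a::ring_1 ^ 'n::finite ^ 'm"
  by (simp add: vec_eq_iff matrix_matrix_mult_def left_diff_distrib sum_subtractf)

lemma matrix_mult_inverses:
  fixes P :: "'a::semiring_1 ^ 'n::finite ^ 'n"
  assumes "invertible P"
  shows "P ** matrix_inv P = mat 1" "matrix_inv P ** P = mat 1"
proof -
  have "P ** matrix_inv P = mat 1 \<and> matrix_inv P ** P = mat 1"
    using assms unfolding invertible_def matrix_inv_def by (rule someI_ex)
  then show "P ** matrix_inv P = mat 1" "matrix_inv P ** P = mat 1" by auto
qed

lemma pencil_eq: "pencil E A s = mat s ** cplx E - cplx A"
  by (simp add: vec_eq_iff pencil_def mat_mult_nth)

text \<open>A nonzero kernel vector would be an eigenvector for s. A trivial kernel gives a left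
  inverse, which for a square matrix is two-sided.\<close>

lemma invertible_pencil:
  fixes E A :: "real ^ 'n ^ 'n"
  assumes "\<not> pencil_eigenvalue E A s"
  shows "invertible (pencil E A s)"
proof -
  have mv: "pencil E A s *v v = s *s (cplx E *v v) - cplx A *v v" for v
    by (simp add: vec_eq_iff pencil_def matrix_vector_mult_def left_diff_distrib
        sum_subtractf sum_distrib_left mult.assoc)
  have "\<forall>v. pencil E A s *v v = 0 \<longrightarrow> v = 0"
    using assms unfolding mv pencil_eigenvalue_def by auto
  then show ?thesis
    by (simp add: invertible_left_inverse matrix_left_invertible_ker)
qed

text \<open>The factor t - s stays on the left, so s = t is covered and division is
  postponed.\<close>

lemma resolvent_identities:
  fixes E A :: "real ^ 'n ^ 'n"
  assumes "invertible (pencil E A s)" and "invertible (pencil E A t)"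
  defines "R \<equiv> matrix_inv (pencil E A s)" and "S \<equiv> matrix_inv (pencil E A t)"
  shows "mat (t - s) ** (R ** cplx E ** S) = R - S"
    and "mat (t - s) ** (R ** cplx A ** S) = mat s ** R - mat t ** S"
proof -
  let ?P = "pencil E A s" and ?Q = "pencil E A t"
  have PQ: "R ** ?P = mat 1" "?Q ** S = mat 1"
    using matrix_mult_inverses assms by auto
  \<comment> \<open>Scalar matrices are central, so the factor t - s can be moved next to E or A,
    where it yields a combination of the two pencils.\<close>
  have pull: "mat c ** (R ** X ** S) = R ** (mat c ** X) ** S" for c X
    by (simp only: matrix_mul_assoc mat_mult_commute[of c R])
  have E: "mat (t - s) ** cplx E = ?Q - ?P"
    by (simp add: vec_eq_iff pencil_eq mat_mult_nth algebra_simps)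
  have A: "mat (t - s) ** cplx A = mat s ** ?Q - mat t ** ?P"
    by (simp add: vec_eq_iff pencil_eq mat_mult_nth algebra_simps)
  \<comment> \<open>Reassociating to the right exposes \<open>?Q ** S\<close>; for \<open>P\<close>
    the default left association already exposes \<open>R ** ?P\<close>.\<close>
  have Q: "R ** ?Q ** S = R"
    by (simp add: PQ flip: matrix_mul_assoc)
  have P: "R ** ?P ** S = S"
    by (simp add: PQ)
  show "mat (t - s) ** (R ** cplx E ** S) = R - S"
    unfolding pull E by (simp add: matrix_diff_ldistrib matrix_diff_rdistrib P Q)
  show "mat (t - s) ** (R ** cplx A ** S) = mat s ** R - mat t ** S"
    unfolding pull A
    \<comment> \<open>Read backwards, \<open>pull\<close> takes s and t out again, so that
      \<open>P\<close> and \<open>Q\<close> apply.\<close>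
    by (simp only: matrix_diff_ldistrib matrix_diff_rdistrib pull[symmetric] P Q)
qed

text \<open>The middle factor is left general to serve both X = E and X = A.\<close>

lemma L_tilde_mult_V_r_nth:
  "(conj_transpose (L_tilde E A C \<omega> \<phi>) ** X ** V_r E A B \<eta>) $ i $ j =
     complex_of_real (\<phi> i) *
       (cplx C ** (matrix_inv (pencil E A (\<i> * complex_of_real (\<omega> i))) ** X **
         matrix_inv (pencil E A (\<eta> j))) ** cplx B) $ 1 $ 1"
  unfolding conj_transpose_L_tilde V_r_def scaled_rows_mult mult_columns
  by (simp add: column_def row_def matrix_mul_assoc)

theorem lemma3p3:
  fixes E A :: "real ^ 'n ^ 'n"
    and B :: "real ^ 1 ^ 'n"
    and C :: "real ^ 'n ^ 1"
    and \<omega> \<phi> :: "'q::finite \<Rightarrow> real"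
    and \<eta> :: "'r::finite \<Rightarrow> complex"
    and i :: 'q and j :: 'r
  defines "H \<equiv> transfer_fun E A B C"
  assumes "invertible E"
    and "\<And>lam. pencil_eigenvalue E A lam \<Longrightarrow> Re lam < 0"
    and "\<And>j. \<not> pencil_eigenvalue E A (\<eta> j)"
  shows "(\<i> * complex_of_real (\<omega> i) \<noteq> \<eta> j \<longrightarrow>
           LL_tilde E A B C \<omega> \<phi> \<eta> $ i $ j =
             - complex_of_real (\<phi> i) *
               ((H (\<i> * complex_of_real (\<omega> i)) - H (\<eta> j)) / (\<i> * complex_of_real (\<omega> i) - \<eta> j))) \<and>
         (\<i> * complex_of_real (\<omega> i) \<noteq> \<eta> j \<longrightarrow>
           MM_tilde E A B C \<omega> \<phi> \<eta> $ i $ j =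
             - complex_of_real (\<phi> i) *
               ((\<i> * complex_of_real (\<omega> i) * H (\<i> * complex_of_real (\<omega> i)) - \<eta> j * H (\<eta> j))
                 / (\<i> * complex_of_real (\<omega> i) - \<eta> j))) \<and>
         VV_tilde E A B C \<omega> \<phi> $ i $ 1 = complex_of_real (\<phi> i) * H (\<i> * complex_of_real (\<omega> i)) \<and>
         WW_tilde E A B C \<eta> $ 1 $ j = H (\<eta> j)"
proof -
  let ?s = "\<i> * complex_of_real (\<omega> i)" and ?t = "\<eta> j"
  let ?R = "matrix_inv (pencil E A ?s)" and ?S = "matrix_inv (pencil E A ?t)"
  \<comment> \<open>The linear functional that turns a resolvent into a value of H.\<close>
  let ?h = "\<lambda>X. (cplx C ** X ** cplx B) $ 1 $ 1"
  have "\<not> pencil_eigenvalue E A ?s"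
    using assms(3)[of ?s] by auto
  then have inv: "invertible (pencil E A ?s)" "invertible (pencil E A ?t)"
    using invertible_pencil assms(4) by blast+
  note res = resolvent_identities[OF inv]
  have H: "H z = ?h (matrix_inv (pencil E A z))" for z
    by (simp add: H_def transfer_fun_def)
  have h_mat: "?h (mat c ** X) = c * ?h X" for c X
  proof -
    \<comment> \<open>Moving past C changes the size of \<open>mat c\<close> from n to 1.\<close>
    have "cplx C ** (mat c ** X) ** cplx B = mat c ** (cplx C ** X ** cplx B)"
      by (simp only: matrix_mul_assoc mat_mult_commute[of c "cplx C", symmetric])
    then show ?thesis by (simp add: mat_mult_nth)
  qed
  have h_diff: "?h (X - Y) = ?h X - ?h Y" for X Y
    by (simp add: matrix_diff_ldistrib matrix_diff_rdistrib)
  have hE: "(?t - ?s) * ?h (?R ** cplx E ** ?S) = H ?s - H ?t"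
    using h_mat[of "?t - ?s" "?R ** cplx E ** ?S"] by (simp only: res h_diff H)
  have hA: "(?t - ?s) * ?h (?R ** cplx A ** ?S) = ?s * H ?s - ?t * H ?t"
    using h_mat[of "?t - ?s" "?R ** cplx A ** ?S"] by (simp only: res h_diff H h_mat)
  \<comment> \<open>The identities carry t - s while the claim divides by s - t; this is the source
    of the minus sign.\<close>
  have div: "x = - (y / (?s - ?t))" if "(?t - ?s) * x = y" "?s \<noteq> ?t" for x y
    using that by (auto simp: field_simps)
  have "VV_tilde E A B C \<omega> \<phi> $ i $ 1 = complex_of_real (\<phi> i) * H ?s"
    unfolding VV_tilde_def conj_transpose_L_tilde scaled_rows_mult
    by (simp add: row_def H)
  moreover have "WW_tilde E A B C \<eta> $ 1 $ j = H ?t"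
    unfolding WW_tilde_def V_r_def mult_columns
    by (simp add: column_def H matrix_mul_assoc)
  ultimately show ?thesis
    using div[OF hE] div[OF hA]
    by (simp add: LL_tilde_def MM_tilde_def L_tilde_mult_V_r_nth)
qed

end
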